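(* Let $g$ be an Einstein metric on a manifold of dimension $n\ge3$, with Levi-Civita connection $\nabla$, and use $g$ to trivialise all density bundles and to split the projective cotractor bundle $\mathcal{T}^*$ of $[\nabla]$ and the conformal cotractor bundle $\widetilde{\mathcal{T}}^*$ of $[g]$. Define a bundle inclusion $\iota:\mathcal{T}^*\to\widetilde{\mathcal{T}}^*$ by, for a projective cotractor $U_A=(\mu_a\mid\sigma)$, $$\iota_\alpha{}^AU_A=\left(\tfrac1n\widetilde{J}\sigma\mid\mu_a\mid\sigma\right).$$ Then: (1) The image of $\iota$ is the kernel of the parallel tractor $I^\alpha$; thus $\iota_\alpha{}^AI^\alpha=0$. (2) The bundle inclusion $\iota$ is connection-preserving, i.e. it intertwines the projective tractor connection on $\mathcal{T}^*$ with the conformal tractor connection on $\widetilde{\mathcal{T}}^*$.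
   Context: Metrics are pseudo-Riemannian; Einstein means $\mathrm{Ric}_{ab}=\lambda g_{ab}$ with $\lambda$ constant, where $(\nabla_a\nabla_b-\nabla_b\nabla_a)v^c=R_{ab}{}^c{}_dv^d$, $\mathrm{Ric}_{ab}=R_{ca}{}^c{}_b$. Projective Schouten tensor of the Levi-Civita connection: $P_{ab}=\frac1{n-1}\mathrm{Ric}_{ab}$. Conformal Schouten tensor $\widetilde P_{ab}$: $\mathrm{Ric}_{ab}=(n-2)\widetilde P_{ab}+\widetilde Jg_{ab}$, $\widetilde J=g^{ab}\widetilde P_{ab}$. Projective cotractors: $\mathcal{T}^*=J^1\mathcal{E}(1)$, where $\mathcal{E}(1)$ is the positive $(2n+2)$-th root of $(\Lambda^nTM)^2$; in the splitting determined by $\nabla$ and with densities trivialised by $g$, $\mathcal{T}^*\cong T^*M\oplus\mathbb{R}$ with sections written $(\mu_a\mid\sigma)$, and the projective tractor connection is $\nabla_b(\mu_a\mid\sigma)=(\nabla_b\mu_a+P_{ab}\sigma\mid\nabla_b\sigma-\mu_b)$. Conformal cotractors: $\widetilde{\mathcal{T}}^*$ is the quotient of $J^2(\mathcal{E}[1])$ (with $\mathcal{E}[1]$ the positive $2n$-th root of $(\Lambda^nTM)^2$) by the sub-bundle of trace-free symmetric 2-tensors of weight 1; in the splitting determined by $g$ and with densities trivialised by $g$, $\widetilde{\mathcal{T}}^*\cong\mathbb{R}\oplus T^*M\oplus\mathbb{R}$ with sections written $V_\alpha=(\tau\mid\mu_a\mid\sigma)$, and the conformal tractor connection is $\widetilde\nabla_b(\tau\mid\mu_a\mid\sigma)=(\nabla_b\tau-\widetilde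 P_{bc}g^{ca}\mu_a\mid\nabla_b\mu_a+g_{ba}\tau+\widetilde P_{ba}\sigma\mid\nabla_b\sigma-\mu_b)$. The tractor $I^\alpha$ is the section of the dual bundle with components $(1,0,-\frac1n\widetilde J)$, i.e. $I^\alpha V_\alpha=\tau-\frac1n\widetilde J\sigma$; it is parallel for the (dual) conformal tractor connection when $g$ is Einstein. Its kernel is the rank-$(n+1)$ sub-bundle $\{V_\alpha:I^\alpha V_\alpha=0\}$ of $\widetilde{\mathcal{T}}^*$. *)

theory Defs
  imports "HOL-Analysis.Analysis"
begin

section \<open>Smooth manifolds\<close>

definition partial :: "'n::finite \<Rightarrow> (real^'n \<Rightarrow> 'b::real_normed_vector) \<Rightarrow> real^'n \<Rightarrow> 'b"
  where "partial i f x = frechet_derivative f (at x) (axis i 1)"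

text \<open>Only used on open sets.\<close>

fun Ck_on :: "nat \<Rightarrow> (real^'n::finite) set \<Rightarrow> (real^'n \<Rightarrow> 'b::real_normed_vector) \<Rightarrow> bool" where
  "Ck_on 0 S f = continuous_on S f"
| "Ck_on (Suc k) S f = (f differentiable_on S \<and> (\<forall>i. Ck_on k S (partial i f)))"

definition smooth_on :: "(real^'n::finite) set \<Rightarrow> (real^'n \<Rightarrow> 'b::real_normed_vector) \<Rightarrow> bool"
  where "smooth_on S f \<longleftrightarrow> (\<forall>k. Ck_on k S f)"

type_synonym ('m, 'n) chart = "'m set \<times> ('m \<Rightarrow> real^'n)"

abbreviation chart_inv :: "('m, 'n::finite) chart \<Rightarrow> real^'n \<Rightarrow> 'm"
  where "chart_inv c \<equiv> inv_into (fst c) (snd c)"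

text \<open>The manifold is the union \<open>carrier A\<close> of the chart domains, an open subset of the ambient
  Hausdorff, second countable space; its dimension is \<open>CARD('n)\<close>.\<close>

definition smooth_atlas :: "('m::{t2_space, second_countable_topology}, 'n::finite) chart set \<Rightarrow> bool"
  where "smooth_atlas A \<longleftrightarrow>
    (\<forall>c\<in>A. open (fst c) \<and> open (snd c ` fst c) \<and>
       homeomorphism (fst c) (snd c ` fst c) (snd c) (chart_inv c)) \<and>
    (\<forall>c\<in>A. \<forall>c'\<in>A. smooth_on (snd c ` (fst c \<inter> fst c')) (snd c' \<circ> chart_inv c))"

definition carrier :: "('m, 'n::finite) chart set \<Rightarrow> 'm set"
  where "carrier A = (\<Union>c\<in>A. fst c)"

definition charts_at :: "('m, 'n::finite) chart set \<Rightarrow> 'm \<Rightarrow> ('m, 'n) chart set"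
  where "charts_at A p = {c \<in> A. p \<in> fst c}"

definition coord_deriv ::
    "('m, 'n::finite) chart \<Rightarrow> 'n \<Rightarrow> ('m \<Rightarrow> 'b::real_normed_vector) \<Rightarrow> 'm \<Rightarrow> 'b"
  where "coord_deriv c i f p = partial i (f \<circ> chart_inv c) (snd c p)"

text \<open>With coordinates \<open>x\<close> of \<open>c\<close> and \<open>y\<close> of \<open>c'\<close>, row \<open>i\<close>, column \<open>j\<close> is
  \<open>\<partial>y\<^sup>i/\<partial>x\<^sup>j\<close>.\<close>

definition jacobian :: "('m, 'n::finite) chart \<Rightarrow> ('m, 'n) chart \<Rightarrow> 'm \<Rightarrow> real^'n^'n"
  where "jacobian c c' p = (\<chi> i j. coord_deriv c j (\<lambda>q. snd c' q $ i) p)"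

section \<open>Vector bundles\<close>

text \<open>A vector bundle with model fibre \<open>'f\<close> is given by transition maps \<open>tr c c' p\<close>, which take
  components with respect to \<open>c'\<close> to components with respect to \<open>c\<close>. An element of the fibre at
  \<open>p\<close> is the compatible family of its components, set to \<open>0\<close> at charts not around \<open>p\<close> so that
  equality of elements is equality of families. Sections are families \<open>s c p\<close> of components.\<close>

type_synonym ('m, 'n, 'f) transition = "('m, 'n) chart \<Rightarrow> ('m, 'n) chart \<Rightarrow> 'm \<Rightarrow> 'f \<Rightarrow> 'f"
type_synonym ('m, 'n, 'f) field = "('m, 'n) chart \<Rightarrow> 'm \<Rightarrow> 'f"

definition fibre :: "('m, 'n::finite) chart set \<Rightarrow> ('m, 'n, 'f::real_normed_vector) transition \<Rightarrow>
    'm \<Rightarrow> (('m, 'n) chart \<Rightarrow> 'f) set"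
  where "fibre A tr p = {v. (\<forall>c\<in>charts_at A p. \<forall>c'\<in>charts_at A p. v c = tr c c' p (v c')) \<and>
    (\<forall>c. c \<notin> charts_at A p \<longrightarrow> v c = 0)}"

definition smooth_section :: "('m::topological_space, 'n::finite) chart set \<Rightarrow>
    ('m, 'n, 'f::real_normed_vector) transition \<Rightarrow> 'm set \<Rightarrow> ('m, 'n, 'f) field \<Rightarrow> bool"
  where "smooth_section A tr W s \<longleftrightarrow> open W \<and> W \<subseteq> carrier A \<and>
    (\<forall>c\<in>A. \<forall>c'\<in>A. \<forall>p\<in>W \<inter> fst c \<inter> fst c'. s c p = tr c c' p (s c' p)) \<and>
    (\<forall>c\<in>A. smooth_on (snd c ` (W \<inter> fst c)) (s c \<circ> chart_inv c))"

definition bundle_map :: "('m, 'n::finite) chart set \<Rightarrow>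
    (('m, 'n) chart \<Rightarrow> 'm \<Rightarrow> 'e \<Rightarrow> 'f::real_normed_vector) \<Rightarrow>
    'm \<Rightarrow> (('m, 'n) chart \<Rightarrow> 'e) \<Rightarrow> (('m, 'n) chart \<Rightarrow> 'f)"
  where "bundle_map A h p v = (\<lambda>c. if c \<in> charts_at A p then h c p (v c) else 0)"

definition bundle_inclusion :: "('m::topological_space, 'n::finite) chart set \<Rightarrow>
    ('m, 'n, 'e::real_normed_vector) transition \<Rightarrow> ('m, 'n, 'f::real_normed_vector) transition \<Rightarrow>
    (('m, 'n) chart \<Rightarrow> 'm \<Rightarrow> 'e \<Rightarrow> 'f) \<Rightarrow> bool"
  where "bundle_inclusion A tr tr' h \<longleftrightarrow>
    (\<forall>c\<in>A. \<forall>p\<in>fst c. linear (h c p) \<and> inj (h c p)) \<and>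
    (\<forall>c\<in>A. \<forall>c'\<in>A. \<forall>p\<in>fst c \<inter> fst c'. \<forall>v. h c p (tr c c' p v) = tr' c c' p (h c' p v)) \<and>
    (\<forall>c\<in>A. \<forall>v. smooth_on (snd c ` fst c) (\<lambda>x. h c (chart_inv c x) v))"

text \<open>A connection \<open>D\<close> sends a section \<open>s\<close> to the components \<open>D s c b p\<close> of
  \<open>\<nabla>\<^sub>b s\<close> at \<open>p\<close>, with respect to the frame of the bundle and the coordinate
  \<open>b\<close> given by \<open>c\<close>.\<close>

type_synonym ('m, 'n, 'f) conn = "('m, 'n, 'f) field \<Rightarrow> ('m, 'n) chart \<Rightarrow> 'n \<Rightarrow> 'm \<Rightarrow> 'f"

definition connection_preserving :: "('m::topological_space, 'n::finite) chart set \<Rightarrow>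
    ('m, 'n, 'e::real_normed_vector) transition \<Rightarrow> ('m, 'n, 'e) conn \<Rightarrow>
    ('m, 'n, 'f::real_normed_vector) conn \<Rightarrow>
    (('m, 'n) chart \<Rightarrow> 'm \<Rightarrow> 'e \<Rightarrow> 'f) \<Rightarrow> bool"
  where "connection_preserving A tr D D' h \<longleftrightarrow>
    (\<forall>W s. smooth_section A tr W s \<longrightarrow> (\<forall>c\<in>A. \<forall>p\<in>W \<inter> fst c. \<forall>b.
       D' (\<lambda>c q. h c q (s c q)) c b p = h c p (D s c b p)))"

text \<open>Sections of the dual bundle pair with \<open>'f\<close> by the inner product of components;
  the dual connection is determined by the Leibniz rule for this pairing.\<close>

definition dual_transition ::
    "('m, 'n, 'f::euclidean_space) transition \<Rightarrow> ('m, 'n, 'f) transition"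
  where "dual_transition tr c c' p = adjoint (tr c' c p)"

definition dual_parallel :: "('m::topological_space, 'n::finite) chart set \<Rightarrow>
    ('m, 'n, 'f::euclidean_space) transition \<Rightarrow> ('m, 'n, 'f) conn \<Rightarrow> ('m, 'n, 'f) field \<Rightarrow> bool"
  where "dual_parallel A tr D t \<longleftrightarrow>
    (\<forall>W s. smooth_section A tr W s \<longrightarrow> (\<forall>c\<in>A. \<forall>p\<in>W \<inter> fst c. \<forall>b.
       coord_deriv c b (\<lambda>q. t c q \<bullet> s c q) p - t c p \<bullet> D s c b p = 0))"

section \<open>Pseudo-Riemannian geometry\<close>

definition metric_transition :: "('m, 'n::finite, real^'n^'n) transition"
  where "metric_transition c c' p h =
    transpose (jacobian c c' p) ** h ** jacobian c c' p"

definition pseudo_riemannian_metric ::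
    "('m::topological_space, 'n::finite) chart set \<Rightarrow> ('m, 'n, real^'n^'n) field \<Rightarrow> bool"
  where "pseudo_riemannian_metric A g \<longleftrightarrow>
    smooth_section A metric_transition (carrier A) g \<and>
    (\<forall>c\<in>A. \<forall>p\<in>fst c. transpose (g c p) = g c p \<and> invertible (g c p))"

text \<open>\<open>christoffel g c p k i j\<close> is \<open>\<Gamma>\<^sup>k\<^sub>i\<^sub>j\<close> of the Levi-Civita connection.\<close>

definition christoffel ::
    "('m, 'n::finite, real^'n^'n) field \<Rightarrow> ('m, 'n) chart \<Rightarrow> 'm \<Rightarrow> 'n \<Rightarrow> 'n \<Rightarrow> 'n \<Rightarrow> real"
  where "christoffel g c p k i j = (1/2) * (\<Sum>l\<in>UNIV. matrix_inv (g c p) $ k $ l *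
    (coord_deriv c i (\<lambda>q. g c q $ j $ l) p + coord_deriv c j (\<lambda>q. g c q $ i $ l) p
      - coord_deriv c l (\<lambda>q. g c q $ i $ j) p))"

text \<open>In the chart \<open>c\<close>: \<open>\<nabla>\<^sub>a v\<^sup>k\<close>, \<open>\<nabla>\<^sub>a T\<^sub>b\<^sup>k\<close> and
  \<open>\<nabla>\<^sub>b \<mu>\<^sub>a\<close>, with \<open>T q b k\<close> standing for \<open>T\<^sub>b\<^sup>k\<close>.\<close>

definition cov_vector :: "('m, 'n::finite, real^'n^'n) field \<Rightarrow> ('m, 'n) chart \<Rightarrow>
    ('m \<Rightarrow> real^'n) \<Rightarrow> 'm \<Rightarrow> 'n \<Rightarrow> 'n \<Rightarrow> real"
  where "cov_vector g c v p a k =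
    coord_deriv c a (\<lambda>q. v q $ k) p + (\<Sum>d\<in>UNIV. christoffel g c p k a d * v p $ d)"

definition cov_endo :: "('m, 'n::finite, real^'n^'n) field \<Rightarrow> ('m, 'n) chart \<Rightarrow>
    ('m \<Rightarrow> 'n \<Rightarrow> 'n \<Rightarrow> real) \<Rightarrow> 'm \<Rightarrow> 'n \<Rightarrow> 'n \<Rightarrow> 'n \<Rightarrow> real"
  where "cov_endo g c T p a b k =
    coord_deriv c a (\<lambda>q. T q b k) p
      - (\<Sum>e\<in>UNIV. christoffel g c p e a b * T p e k)
      + (\<Sum>e\<in>UNIV. christoffel g c p k a e * T p b e)"

definition cov_covector :: "('m, 'n::finite, real^'n^'n) field \<Rightarrow> ('m, 'n) chart \<Rightarrow>
    ('m \<Rightarrow> real^'n) \<Rightarrow> 'm \<Rightarrow> 'n \<Rightarrow> 'n \<Rightarrow> real"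
  where "cov_covector g c \<mu> p b a =
    coord_deriv c b (\<lambda>q. \<mu> q $ a) p - (\<Sum>d\<in>UNIV. christoffel g c p d b a * \<mu> p $ d)"

text \<open>\<open>riemann g c p a b k d\<close> is \<open>R\<^sub>a\<^sub>b\<^sup>k\<^sub>d\<close> in
  \<open>(\<nabla>\<^sub>a \<nabla>\<^sub>b - \<nabla>\<^sub>b \<nabla>\<^sub>a) v\<^sup>k = R\<^sub>a\<^sub>b\<^sup>k\<^sub>d v\<^sup>d\<close>. The left-hand
  side is linear over functions in \<open>v\<close>, so its components are its values on the coordinate
  fields \<open>v = \<partial>\<^sub>d\<close>.\<close>

definition riemann :: "('m, 'n::finite, real^'n^'n) field \<Rightarrow> ('m, 'n) chart \<Rightarrow> 'm \<Rightarrow>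
    'n \<Rightarrow> 'n \<Rightarrow> 'n \<Rightarrow> 'n \<Rightarrow> real"
  where "riemann g c p a b k d =
    cov_endo g c (cov_vector g c (\<lambda>_. axis d 1)) p a b k
      - cov_endo g c (cov_vector g c (\<lambda>_. axis d 1)) p b a k"

definition ricci :: "('m, 'n::finite, real^'n^'n) field \<Rightarrow> ('m, 'n, real^'n^'n) field"
  where "ricci g c p = (\<chi> a b. \<Sum>k\<in>UNIV. riemann g c p k a k b)"

definition einstein :: "('m, 'n::finite) chart set \<Rightarrow> ('m, 'n, real^'n^'n) field \<Rightarrow> bool"
  where "einstein A g \<longleftrightarrow> (\<exists>l::real. \<forall>c\<in>A. \<forall>p\<in>fst c. ricci g c p = l *\<^sub>R g c p)"

definition proj_schouten :: "('m, 'n::finite, real^'n^'n) field \<Rightarrow> ('m, 'n, real^'n^'n) field"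
  where "proj_schouten g c p = (1 / (real CARD('n) - 1)) *\<^sub>R ricci g c p"

definition metric_trace :: "real^'n^'n \<Rightarrow> real^'n^'n \<Rightarrow> real"
  where "metric_trace h P = (\<Sum>a\<in>UNIV. \<Sum>b\<in>UNIV. matrix_inv h $ a $ b * P $ a $ b)"

text \<open>The defining equation has exactly one solution for \<open>CARD('n) \<ge> 3\<close>, see
  \<open>schouten_ex1\<close> below.\<close>

definition conf_schouten :: "('m, 'n::finite, real^'n^'n) field \<Rightarrow> ('m, 'n, real^'n^'n) field"
  where "conf_schouten g c p =
    (THE P. ricci g c p = (real CARD('n) - 2) *\<^sub>R P + metric_trace (g c p) P *\<^sub>R g c p)"

definition conf_J :: "('m, 'n::finite, real^'n^'n) field \<Rightarrow> ('m, 'n, real) field"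
  where "conf_J g c p = metric_trace (g c p) (conf_schouten g c p)"

lemma transpose_eqD: "transpose h = h \<Longrightarrow> h $ a $ b = h $ b $ a"
  by (drule arg_cong[where f = "\<lambda>m. m $ b $ a"]) (simp add: transpose_def)

lemma metric_trace_self:
  fixes h :: "real^'n^'n"
  assumes "transpose h = h" "invertible h"
  shows "metric_trace h h = real CARD('n)"
proof -
  have inv: "matrix_inv h ** h = mat 1"
    using assms(2) unfolding invertible_def matrix_inv_def by (metis (mono_tags, lifting) someI_ex)
  have s: "h $ a $ b = h $ b $ a" for a b
    by (rule transpose_eqD[OF assms(1)])
  have "metric_trace h h = (\<Sum>a\<in>UNIV. (matrix_inv h ** h) $ a $ a)"
    unfolding metric_trace_def matrix_matrix_mult_def using s by simp
  also have "\<dots> = real CARD('n)" by (simp add: inv mat_def)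
  finally show ?thesis .
qed

lemma metric_trace_lin:
  "metric_trace h (x *\<^sub>R P + y *\<^sub>R Q) = x * metric_trace h P + y * metric_trace h Q"
  unfolding metric_trace_def
  by (simp add: algebra_simps sum.distrib sum_distrib_left)

lemma schouten_ex1:
  fixes h R :: "real^'n^'n"
  assumes "transpose h = h" "invertible h" and n: "CARD('n) \<ge> 3"
  shows "\<exists>!P. R = (real CARD('n) - 2) *\<^sub>R P + metric_trace h P *\<^sub>R h"
proof -
  define n where "n = real CARD('n)"
  have n3: "n \<ge> 3" using n unfolding n_def by simp
  have trh: "metric_trace h h = n" using metric_trace_self assms unfolding n_def by blast
  define J where "J = metric_trace h R / (2 * (n - 1))"
  have trR: "metric_trace h R = 2 * (n - 1) * J" using n3 unfolding J_def by simp
  define P0 where "P0 = (1 / (n - 2)) *\<^sub>R R + (- J / (n - 2)) *\<^sub>R h"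
  have trP: "metric_trace h P0 = J"
  proof -
    have "metric_trace h P0 = (J * (n - 2)) / (n - 2)"
      unfolding P0_def metric_trace_lin trR trh by (simp add: field_simps diff_divide_distrib)
    thus ?thesis using n3 by simp
  qed
  show ?thesis unfolding n_def[symmetric]
  proof (rule ex1I[of _ P0])
    show "R = (n - 2) *\<^sub>R P0 + metric_trace h P0 *\<^sub>R h"
      unfolding trP unfolding P0_def using n3 by (simp add: scaleR_right_diff_distrib)
  next
    fix P assume e: "R = (n - 2) *\<^sub>R P + metric_trace h P *\<^sub>R h"
    have "metric_trace h R = (n - 2) * metric_trace h P + metric_trace h P * n"
      by (subst e) (simp add: metric_trace_lin trh)
    hence "2 * (n - 1) * metric_trace h P = 2 * (n - 1) * J"
      unfolding trR by (simp add: algebra_simps)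
    hence t: "metric_trace h P = J" using n3 by simp
    have "(n - 2) *\<^sub>R P = R - J *\<^sub>R h" using e unfolding t by (simp add: algebra_simps)
    hence "(1 / (n - 2)) *\<^sub>R ((n - 2) *\<^sub>R P) = (1 / (n - 2)) *\<^sub>R (R - J *\<^sub>R h)" by simp
    thus "P = P0" unfolding P0_def using n3 by (simp add: scaleR_right_diff_distrib)
  qed
qed

lemma conf_schouten_eq:
  fixes g :: "('m, 'n::finite, real^'n^'n) field"
  assumes "transpose (g c p) = g c p" "invertible (g c p)" "CARD('n) \<ge> 3"
  shows "ricci g c p = (real CARD('n) - 2) *\<^sub>R conf_schouten g c p + conf_J g c p *\<^sub>R g c p"
  unfolding conf_J_def conf_schouten_def by (rule theI') (rule schouten_ex1[OF assms])

lemma coord_deriv_metric_sym: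
  assumes "smooth_atlas A" "pseudo_riemannian_metric A g" "c \<in> A" "p \<in> fst c"
  shows "coord_deriv c l (\<lambda>q. g c q $ i $ j) p = coord_deriv c l (\<lambda>q. g c q $ j $ i) p"
proof -
  have s: "g c q $ i $ j = g c q $ j $ i" if "q \<in> fst c" for q i j
    using assms(2,3) that unfolding pseudo_riemannian_metric_def
    by (intro transpose_eqD) blast
  have o: "open (snd c ` fst c)" using assms(1,3) unfolding smooth_atlas_def by blast
  have "((\<lambda>q. g c q $ b $ a) \<circ> chart_inv c has_derivative D) (at (snd c p))"
    if "((\<lambda>q. g c q $ a $ b) \<circ> chart_inv c has_derivative D) (at (snd c p))" for D a b
    by (rule has_derivative_transform_within_open[OF that o])
      (use assms(4) s[of _ a b] in \<open>auto simp: inv_into_into\<close>)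
  hence "((\<lambda>q. g c q $ i $ j) \<circ> chart_inv c has_derivative D) (at (snd c p)) \<longleftrightarrow>
      ((\<lambda>q. g c q $ j $ i) \<circ> chart_inv c has_derivative D) (at (snd c p))" for D
    by blast
  thus ?thesis unfolding coord_deriv_def partial_def frechet_derivative_def by simp
qed

text \<open>The connection with these Christoffel symbols is torsion-free and metric.\<close>

lemma christoffel_sym:
  assumes "smooth_atlas A" "pseudo_riemannian_metric A g" "c \<in> A" "p \<in> fst c"
  shows "christoffel g c p k i j = christoffel g c p k j i"
  unfolding christoffel_def using coord_deriv_metric_sym[OF assms, of _ i j] by (simp add: add.commute)

lemma christoffel_metric:
  fixes g :: "('m::{t2_space, second_countable_topology}, 'n::finite, real^'n^'n) field"
  assumes A: "smooth_atlas A" "pseudo_riemannian_metric A g" "c \<in> A" "p \<in> fst c"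
  shows "coord_deriv c l (\<lambda>q. g c q $ i $ j) p
      - (\<Sum>k\<in>UNIV. christoffel g c p k l i * g c p $ k $ j)
      - (\<Sum>k\<in>UNIV. christoffel g c p k l j * g c p $ i $ k) = 0"
proof -
  note sy = coord_deriv_metric_sym[OF A]
  have ts: "transpose (g c p) = g c p" and iv: "invertible (g c p)"
    using A unfolding pseudo_riemannian_metric_def by auto
  have inv: "g c p ** matrix_inv (g c p) = mat 1"
    using iv unfolding invertible_def matrix_inv_def by (metis (mono_tags, lifting) someI_ex)
  have s: "g c p $ a $ b = g c p $ b $ a" for a b
    by (rule transpose_eqD[OF ts])
  have delta: "(\<Sum>l\<in>UNIV. (mat 1 :: real^'n^'n) $ m $ l * f l) = f m" for m f
    by (simp add: mat_def if_distrib[of "\<lambda>x. x * _"] cong: if_cong)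
  let ?K = "\<lambda>i j l. coord_deriv c i (\<lambda>q. g c q $ j $ l) p + coord_deriv c j (\<lambda>q. g c q $ i $ l) p
      - coord_deriv c l (\<lambda>q. g c q $ i $ j) p"
  have lower: "(\<Sum>k\<in>UNIV. g c p $ m $ k * christoffel g c p k i j) = (1/2) * ?K i j m" for i j m
  proof -
    have "(\<Sum>k\<in>UNIV. g c p $ m $ k * christoffel g c p k i j)
      = (\<Sum>k\<in>UNIV. \<Sum>l\<in>UNIV. g c p $ m $ k * (matrix_inv (g c p) $ k $ l * (1/2 * ?K i j l)))"
      unfolding christoffel_def sum_distrib_left by (simp add: mult.left_commute)
    also have "\<dots> = (\<Sum>l\<in>UNIV. (\<Sum>k\<in>UNIV. g c p $ m $ k * matrix_inv (g c p) $ k $ l) * (1/2 * ?K i j l))"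
      by (subst sum.swap) (simp only: sum_distrib_right mult.assoc)
    also have "\<dots> = (\<Sum>l\<in>UNIV. (mat 1 :: real^'n^'n) $ m $ l * (1/2 * ?K i j l))"
      by (subst inv[symmetric]) (simp add: matrix_matrix_mult_def)
    also have "\<dots> = (1/2) * ?K i j m" by (rule delta)
    finally show ?thesis .
  qed
  have a: "(\<Sum>k\<in>UNIV. christoffel g c p k l i * g c p $ k $ j) = (1/2) * ?K l i j"
    unfolding lower[of j l i, symmetric] by (intro sum.cong refl) (metis s mult.commute)
  have b: "(\<Sum>k\<in>UNIV. christoffel g c p k l j * g c p $ i $ k) = (1/2) * ?K l j i"
    unfolding lower[of i l j, symmetric] by (intro sum.cong refl) (rule mult.commute)
  have "x - (1/2) * (x + y - z) - (1/2) * (x + z - y) = 0" for x y z :: real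
    by (simp add: field_simps)
  thus ?thesis unfolding a b sy[of l j i] by blast
qed

section \<open>Tractors\<close>

text \<open>Cotractors in the splitting determined by the metric, with densities trivialised by it:
  \<open>(\<mu>, \<sigma>)\<close> in the projective case, \<open>(\<tau>, \<mu>, \<sigma>)\<close> in the conformal one. The
  splitting is global, so only the coordinates of \<open>\<mu>\<close> change between charts.\<close>

type_synonym 'n proj_cotractor = "(real^'n) \<times> real"
type_synonym 'n conf_cotractor = "real \<times> (real^'n) \<times> real"

definition proj_transition :: "('m, 'n::finite, 'n proj_cotractor) transition"
  where "proj_transition c c' p U = (transpose (jacobian c c' p) *v fst U, snd U)"

definition conf_transition :: "('m, 'n::finite, 'n conf_cotractor) transition"
  where "conf_transition c c' p V =
    (fst V, transpose (jacobian c c' p) *v fst (snd V), snd (snd V))"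

definition proj_tractor_conn ::
    "('m, 'n::finite, real^'n^'n) field \<Rightarrow> ('m, 'n, 'n proj_cotractor) conn"
  where "proj_tractor_conn g s c b p =
    (let \<mu> = \<lambda>q. fst (s c q); \<sigma> = \<lambda>q. snd (s c q) in
      (\<chi> a. cov_covector g c \<mu> p b a + proj_schouten g c p $ a $ b * \<sigma> p,
       coord_deriv c b \<sigma> p - \<mu> p $ b))"

definition conf_tractor_conn ::
    "('m, 'n::finite, real^'n^'n) field \<Rightarrow> ('m, 'n, 'n conf_cotractor) conn"
  where "conf_tractor_conn g s c b p =
    (let \<tau> = \<lambda>q. fst (s c q); \<mu> = \<lambda>q. fst (snd (s c q)); \<sigma> = \<lambda>q. snd (snd (s c q)) in
      (coord_deriv c b \<tau> p - (\<Sum>d\<in>UNIV. \<Sum>a\<in>UNIV.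
         conf_schouten g c p $ b $ d * matrix_inv (g c p) $ d $ a * \<mu> p $ a),
       \<chi> a. cov_covector g c \<mu> p b a + g c p $ b $ a * \<tau> p
         + conf_schouten g c p $ b $ a * \<sigma> p,
       coord_deriv c b \<sigma> p - \<mu> p $ b))"

definition tractor_I :: "('m, 'n::finite, real^'n^'n) field \<Rightarrow> ('m, 'n, 'n conf_cotractor) field"
  where "tractor_I g c p = (1, 0, - (1 / real CARD('n)) * conf_J g c p)"

definition ker_I :: "('m, 'n::finite) chart set \<Rightarrow> ('m, 'n, real^'n^'n) field \<Rightarrow> 'm \<Rightarrow>
    (('m, 'n) chart \<Rightarrow> 'n conf_cotractor) set"
  where "ker_I A g p =
    {V \<in> fibre A conf_transition p. \<forall>c\<in>charts_at A p. tractor_I g c p \<bullet> V c = 0}"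

definition iota :: "('m, 'n::finite, real^'n^'n) field \<Rightarrow> ('m, 'n) chart \<Rightarrow> 'm \<Rightarrow>
    'n proj_cotractor \<Rightarrow> 'n conf_cotractor"
  where "iota g c p U = ((1 / real CARD('n)) * conf_J g c p * snd U, fst U, snd U)"

end

theory Submission
  imports Defs
begin

text \<open>The Einstein equation \<open>Ric = \<lambda> g\<close> makes both Schouten tensors constant multiples of
  the metric: with \<open>\<kappa> = \<lambda> / (2 (n - 1))\<close> the conformal one is \<open>\<kappa> g\<close> and the
  projective one is \<open>2 \<kappa> g\<close>, so \<open>J / n = \<kappa>\<close> is constant. In the middle slot of the
  conformal connection, \<open>\<iota>\<close> contributes \<open>\<kappa> g \<sigma>\<close> twice, through
  \<open>\<tau> = \<kappa> \<sigma>\<close> and through the conformal Schouten tensor, and the sum is the projective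
  Schouten term; in the top slot one gets \<open>\<kappa> (\<nabla>\<^sub>b \<sigma> - \<mu>\<^sub>b)\<close>.\<close>

lemma schouten_Einstein:
  fixes g :: "('m, 'n::finite, real^'n^'n) field"
  assumes g: "transpose (g c p) = g c p" "invertible (g c p)" and n: "CARD('n) \<ge> 3"
    and ric: "ricci g c p = l *\<^sub>R g c p"
  defines "k \<equiv> l / (2 * (real CARD('n) - 1))"
  shows "conf_schouten g c p = k *\<^sub>R g c p" "conf_J g c p = real CARD('n) * k"
    "proj_schouten g c p = (2 * k) *\<^sub>R g c p"
proof -
  have n3: "real CARD('n) \<ge> 3" using n by simp
  have tr: "metric_trace (g c p) (k *\<^sub>R g c p) = real CARD('n) * k"
    using metric_trace_lin[of "g c p" k "g c p" 0 0] metric_trace_self[OF g] by simp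
  \<comment> \<open>Putting P = k g into the Schouten equation gives g the coefficient (n - 2) k + n
    k, which explains the factor 2 (n - 1) in \<open>k\<close>.\<close>
  have "2 * (real CARD('n) - 1) * k = l"
    using n3 unfolding k_def by simp
  hence "l = (real CARD('n) - 2) * k + real CARD('n) * k"
    by (simp add: algebra_simps)
  hence "ricci g c p = (real CARD('n) - 2) *\<^sub>R (k *\<^sub>R g c p)
      + metric_trace (g c p) (k *\<^sub>R g c p) *\<^sub>R g c p"
    unfolding ric tr scaleR_scaleR scaleR_add_left[symmetric] by (rule arg_cong)
  \<comment> \<open>\<open>conf_schouten\<close> is a definite description, so by uniqueness one
    verified solution determines it.\<close>
  thus S: "conf_schouten g c p = k *\<^sub>R g c p"
    unfolding conf_schouten_def by (rule the1_equality[OF schouten_ex1[OF g n]])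
  show "conf_J g c p = real CARD('n) * k" unfolding conf_J_def S by (rule tr)
  show "proj_schouten g c p = (2 * k) *\<^sub>R g c p"
    unfolding proj_schouten_def ric using n3 by (simp add: k_def field_simps)
qed

section \<open>Derivatives and smoothness in charts\<close>

lemma Ck_on_locally_const:
  assumes "open S" "\<And>x. x \<in> S \<Longrightarrow> f x = a"
  shows "Ck_on k S f"
  using assms(2)
\<comment> \<open>The partial derivatives vanish on \<open>S\<close>, so they are constant there
  again, with 0 for \<open>a\<close>; hence \<open>f\<close> and \<open>a\<close> vary in the
  induction.\<close>
proof (induction k arbitrary: f a)
  case 0
  then show ?case using continuous_on_cong[of S S f "\<lambda>_. a"] by simp
next
  case (Suc k)
  have d: "(f has_derivative (\<lambda>_. 0)) (at x)" if "x \<in> S" for x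
    by (rule has_derivative_transform_within_open[OF has_derivative_const assms(1) that])
      (simp add: Suc.prems)
  have "partial i f x = 0" if "x \<in> S" for i x
    unfolding partial_def using frechet_derivative_at[OF d[OF that]] by metis
  moreover have "f differentiable_on S"
    using d by (meson differentiable_at_withinI differentiable_def differentiable_on_def)
  ultimately show ?case using Suc.IH by simp
qed

lemma smooth_on_locally_const:
  assumes "open S" "\<And>x. x \<in> S \<Longrightarrow> f x = a"
  shows "smooth_on S f"
  unfolding smooth_on_def using Ck_on_locally_const[of S f a] assms by simp

text \<open>Closed forms of \<open>iota\<close> and \<open>tractor_I\<close> are available on chart
  domains only, while \<open>coord_deriv\<close> acts on functions on the whole type. The two
  functions have the same derivatives at \<open>p\<close>, so the choice in
  \<open>frechet_derivative\<close> agrees even where no derivative exists.\<close>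

lemma coord_deriv_cong:
  assumes "open (snd c ` fst c)" "p \<in> fst c" "\<And>q. q \<in> fst c \<Longrightarrow> f q = f' q"
  shows "coord_deriv c b f p = coord_deriv c b f' p"
proof -
  have "(f2 \<circ> chart_inv c has_derivative D) (at (snd c p))"
    if "(f1 \<circ> chart_inv c has_derivative D) (at (snd c p))" "\<And>q. q \<in> fst c \<Longrightarrow> f1 q = f2 q"
    for D f1 f2
    by (rule has_derivative_transform_within_open[OF that(1) assms(1)])
      (use assms(2) that(2) in \<open>auto simp: inv_into_into\<close>)
  hence "(f \<circ> chart_inv c has_derivative D) (at (snd c p)) \<longleftrightarrow>
      (f' \<circ> chart_inv c has_derivative D) (at (snd c p))" for D
    using assms(3) by metis
  thus ?thesis unfolding coord_deriv_def partial_def frechet_derivative_def by simp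
qed

text \<open>Moves slot projections and the pairing with a constant dual tractor out of a derivative.
  Differentiability excludes the arbitrary value of \<open>frechet_derivative\<close>.\<close>

lemma coord_deriv_bounded_linear:
  assumes "bounded_linear h" "(f \<circ> chart_inv c) differentiable (at (snd c p))"
  shows "coord_deriv c b (\<lambda>q. h (f q)) p = h (coord_deriv c b f p)"
proof -
  have "((\<lambda>x. h ((f \<circ> chart_inv c) x)) has_derivative
      (\<lambda>x. h (frechet_derivative (f \<circ> chart_inv c) (at (snd c p)) x))) (at (snd c p))"
    using assms bounded_linear.has_derivative frechet_derivative_works by blast
  from frechet_derivative_at[OF this, symmetric] show ?thesis
    unfolding coord_deriv_def partial_def by (simp add: comp_def)
qed

text \<open>A chart is a homeomorphism onto an open set, so the image of
  \<open>W \<inter> fst c\<close> is open, and differentiability within it is differentiability at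
  each of its points.\<close>

lemma smooth_section_differentiable:
  assumes "smooth_atlas A" "smooth_section A tr W s" "c \<in> A" "p \<in> W \<inter> fst c"
  shows "(s c \<circ> chart_inv c) differentiable (at (snd c p))"
proof -
  let ?S = "snd c ` (W \<inter> fst c)"
  have h: "homeomorphism (fst c) (snd c ` fst c) (snd c) (chart_inv c)"
    and o: "open (snd c ` fst c)"
    using assms(1,3) unfolding smooth_atlas_def by auto
  have "openin (top_of_set (fst c)) (W \<inter> fst c)"
    using assms(2) openin_open_Int[of W "fst c"] Int_commute[of W "fst c"]
    unfolding smooth_section_def by simp
  hence "open ?S"
    using homeomorphism_imp_open_map[OF h] o openin_open_eq by blast
  moreover have "(s c \<circ> chart_inv c) differentiable_on ?S"
    using assms(2,3) Ck_on.simps(2) unfolding smooth_section_def smooth_on_def by blast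
  ultimately show ?thesis
    using assms(4) differentiable_on_eq_differentiable_at by blast
qed

section \<open>Fibres and transition maps\<close>

lemma fibreI:
  assumes "\<And>c c'. c \<in> charts_at A p \<Longrightarrow> c' \<in> charts_at A p \<Longrightarrow> v c = tr c c' p (v c')"
    and "\<And>c. c \<notin> charts_at A p \<Longrightarrow> v c = 0"
  shows "v \<in> fibre A tr p"
  unfolding fibre_def mem_Collect_eq by (intro conjI ballI allI impI assms)

lemma fibreD:
  assumes "v \<in> fibre A tr p"
  shows "c \<in> charts_at A p \<Longrightarrow> c' \<in> charts_at A p \<Longrightarrow> v c = tr c c' p (v c')"
    and "c \<notin> charts_at A p \<Longrightarrow> v c = 0"
  using assms unfolding fibre_def by blast+

lemma open_carrier:
  assumes "smooth_atlas A"
  shows "open (carrier A)"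
  using assms unfolding smooth_atlas_def carrier_def by blast

lemma linear_conf_transition: "linear (conf_transition c c' p)"
  unfolding conf_transition_def
  by (rule linearI) (simp_all add: matrix_vector_right_distrib matrix_vector_mult_scaleR)

text \<open>Transitions change only the middle slot, and a dual tractor with zero middle slot does
  not see that change. This makes the constant components of \<open>tractor_I\<close> compatible
  between charts.\<close>

lemma dual_conf_transition_invariant:
  "dual_transition conf_transition c c' p (a, 0, b) = (a, 0, b)"
proof -
  have "x \<bullet> dual_transition conf_transition c c' p (a, 0, b) = x \<bullet> (a, 0, b)" for x
    unfolding dual_transition_def adjoint_works[OF linear_conf_transition]
    by (simp add: conf_transition_def inner_prod_def)
  thus ?thesis using vector_eq_ldot by blast
qed

section \<open>The inclusion and its properties\<close>

theorem proposition8p6: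
  fixes A :: "('m::{t2_space, second_countable_topology}, 'n::finite) chart set"
    and g :: "('m, 'n, real^'n^'n) field"
  assumes "smooth_atlas A"
    and "pseudo_riemannian_metric A g"
    and "einstein A g"
    and "CARD('n) \<ge> 3"
  shows "bundle_inclusion A proj_transition conf_transition (iota g) \<and>
    smooth_section A (dual_transition conf_transition) (carrier A) (tractor_I g) \<and>
    dual_parallel A conf_transition (conf_tractor_conn g) (tractor_I g) \<and>
    (\<forall>p\<in>carrier A. bundle_map A (iota g) p ` fibre A proj_transition p = ker_I A g p) \<and>
    (\<forall>c\<in>A. \<forall>p\<in>fst c. \<forall>U. tractor_I g c p \<bullet> iota g c p U = 0) \<and>
    connection_preserving A proj_transition (proj_tractor_conn g) (conf_tractor_conn g) (iota g)"
proof -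
  obtain l where l: "\<And>c p. c \<in> A \<Longrightarrow> p \<in> fst c \<Longrightarrow> ricci g c p = l *\<^sub>R g c p"
    using assms(3) unfolding einstein_def by blast
  define k where "k = l / (2 * (real CARD('n) - 1))"
  have sym: "transpose (g c p) = g c p" and inv: "invertible (g c p)"
    if "c \<in> A" "p \<in> fst c" for c p
    using assms(2) that unfolding pseudo_riemannian_metric_def by blast+
  note E = schouten_Einstein[OF sym inv assms(4) l, folded k_def]
  have I: "tractor_I g c p = (1, 0, - k)" if "c \<in> A" "p \<in> fst c" for c p
    using E(2)[OF that that that] by (simp add: tractor_I_def)
  have iota: "iota g c p U = (k * snd U, fst U, snd U)" if "c \<in> A" "p \<in> fst c" for c p U
    using E(2)[OF that that that] by (simp add: iota_def)
  have op: "open (snd c ` fst c)" if "c \<in> A" for c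
    using assms(1) that unfolding smooth_atlas_def by blast
  have ch: "chart_inv c x \<in> fst c" if "x \<in> snd c ` fst c" for c :: "('m, 'n) chart" and x
    using that by (rule inv_into_into)
  \<comment> \<open>The Schouten term in the top slot of the conformal connection: the metric in P =
    k g cancels the inverse metric.\<close>
  have raise: "(\<Sum>d\<in>UNIV. \<Sum>a\<in>UNIV. conf_schouten g c p $ b $ d * matrix_inv (g c p) $ d $ a * v $ a)
      = k * v $ b" if "c \<in> A" "p \<in> fst c" for c p b and v :: "real^'n"
  proof -
    have "g c p ** matrix_inv (g c p) = mat 1"
      using inv[OF that] unfolding invertible_def matrix_inv_def
      by (metis (mono_tags, lifting) someI_ex)
    hence "k * v $ b = k * (g c p *v (matrix_inv (g c p) *v v)) $ b"
      by (simp add: matrix_vector_mul_assoc)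
    thus ?thesis
      unfolding E(1)[OF that that that] matrix_vector_mult_def
      by (simp add: sum_distrib_left mult.assoc)
  qed

  have "bundle_inclusion A proj_transition conf_transition (iota g)"
    unfolding bundle_inclusion_def
  proof (intro conjI ballI allI)
    fix c p assume c: "c \<in> A" "p \<in> fst c"
    show "linear (iota g c p)"
      by (rule linearI) (simp_all add: iota[OF c] prod_eq_iff distrib_left)
    show "inj (iota g c p)"
      by (rule injI) (simp add: iota_def prod_eq_iff)
  next
    fix c c' p v assume "c \<in> A" "c' \<in> A" "p \<in> fst c \<inter> fst c'"
    then show "iota g c p (proj_transition c c' p v) = conf_transition c c' p (iota g c' p v)"
      by (simp add: iota proj_transition_def conf_transition_def)
  next
    fix c v assume c: "c \<in> A"
    \<comment> \<open>J / n is the constant \<open>k\<close>, so for fixed \<open>v\<close> the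
      components do not depend on the point.\<close>
    show "smooth_on (snd c ` fst c) (\<lambda>x. iota g c (chart_inv c x) v)"
      by (rule smooth_on_locally_const[OF op[OF c]]) (rule iota[OF c ch])
  qed
  moreover have "smooth_section A (dual_transition conf_transition) (carrier A) (tractor_I g)"
    unfolding smooth_section_def
  proof (intro conjI ballI)
    fix c assume c: "c \<in> A"
    hence "carrier A \<inter> fst c = fst c" unfolding carrier_def by blast
    moreover have "smooth_on (snd c ` fst c) (tractor_I g c \<circ> chart_inv c)"
      by (rule smooth_on_locally_const[OF op[OF c]]) (simp add: I[OF c ch])
    ultimately show "smooth_on (snd c ` (carrier A \<inter> fst c)) (tractor_I g c \<circ> chart_inv c)"
      by simp
  qed (simp_all add: open_carrier[OF assms(1)] I dual_conf_transition_invariant)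
  moreover have "dual_parallel A conf_transition (conf_tractor_conn g) (tractor_I g)"
    unfolding dual_parallel_def
  proof (intro allI impI ballI)
    fix W s c p b
    assume s: "smooth_section A conf_transition W s" and c: "c \<in> A" and p: "p \<in> W \<inter> fst c"
    have p': "p \<in> fst c" using p by blast
    note D = coord_deriv_bounded_linear[OF _ smooth_section_differentiable[OF assms(1) s c p], of _ b]
    have "coord_deriv c b (\<lambda>q. tractor_I g c q \<bullet> s c q) p
        = coord_deriv c b (\<lambda>q. (1, 0, - k) \<bullet> s c q) p"
      by (rule coord_deriv_cong[OF op[OF c] p']) (simp add: I[OF c])
    then have d: "coord_deriv c b (\<lambda>q. tractor_I g c q \<bullet> s c q) p
        = (1, 0, - k) \<bullet> coord_deriv c b (s c) p"
      unfolding D[OF bounded_linear_inner_right] .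
    \<comment> \<open>The top slot contributes -k \<mu>_b and the bottom slot, weighted by -k,
      contributes +k \<mu>_b; what remains is the derivative of \<tau> - k \<sigma>.\<close>
    show "coord_deriv c b (\<lambda>q. tractor_I g c q \<bullet> s c q) p
        - tractor_I g c p \<bullet> conf_tractor_conn g s c b p = 0"
      unfolding d conf_tractor_conn_def Let_def raise[OF c p'] I[OF c p']
      using D[OF bounded_linear_fst]
        D[OF bounded_linear_compose[OF bounded_linear_snd bounded_linear_snd]]
      by (simp add: inner_prod_def algebra_simps)
  qed
  moreover have "bundle_map A (iota g) p ` fibre A proj_transition p = ker_I A g p" for p
  proof (intro equalityI subsetI)
    fix V assume "V \<in> bundle_map A (iota g) p ` fibre A proj_transition p"
    then obtain u where V: "V = bundle_map A (iota g) p u" and u: "u \<in> fibre A proj_transition p"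
      by (rule imageE)
    have Vc: "V c = (k * snd (u c), u c)" if "c \<in> charts_at A p" for c
      using that by (simp add: V bundle_map_def charts_at_def iota)
    have "V c = conf_transition c c' p (V c')"
      if cc: "c \<in> charts_at A p" "c' \<in> charts_at A p" for c c'
    proof -
      show ?thesis
        unfolding Vc[OF cc(1)] Vc[OF cc(2)] fibreD(1)[OF u cc]
        by (simp add: conf_transition_def proj_transition_def)
    qed
    moreover have "V c = 0" if "c \<notin> charts_at A p" for c
      using that by (simp add: V bundle_map_def)
    ultimately have "V \<in> fibre A conf_transition p" by (rule fibreI)
    moreover have "tractor_I g c p \<bullet> V c = 0" if "c \<in> charts_at A p" for c
      using that Vc[OF that] by (simp add: charts_at_def I inner_prod_def)
    ultimately show "V \<in> ker_I A g p" unfolding ker_I_def by simp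
  next
    fix V assume "V \<in> ker_I A g p"
    then have V: "V \<in> fibre A conf_transition p"
      and ker: "\<And>c. c \<in> charts_at A p \<Longrightarrow> tractor_I g c p \<bullet> V c = 0"
      unfolding ker_I_def by simp_all
    \<comment> \<open>In the kernel \<tau> = k \<sigma>, so the preimage is found by dropping the
      top slot; on the other two slots the transitions agree.\<close>
    have "(\<lambda>c. snd (V c)) \<in> fibre A proj_transition p"
    proof (rule fibreI)
      fix c c' assume cc: "c \<in> charts_at A p" "c' \<in> charts_at A p"
      show "snd (V c) = proj_transition c c' p (snd (V c'))"
        unfolding fibreD(1)[OF V cc] by (simp add: conf_transition_def proj_transition_def)
    qed (simp add: fibreD(2)[OF V])
    \<comment> \<open>Equality of fibre elements is equality of families, so charts not around
      \<open>p\<close> count too; there both sides are 0.\<close>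
    moreover have "V c = bundle_map A (iota g) p (\<lambda>c. snd (V c)) c" for c
    proof (cases "c \<in> charts_at A p")
      case True
      with ker[OF True] show ?thesis
        by (simp add: bundle_map_def charts_at_def iota I inner_prod_def prod_eq_iff)
    next
      case False
      then show ?thesis by (simp add: bundle_map_def fibreD(2)[OF V])
    qed
    hence "V = bundle_map A (iota g) p (\<lambda>c. snd (V c))" by (rule ext)
    ultimately show "V \<in> bundle_map A (iota g) p ` fibre A proj_transition p"
      by (rule rev_image_eqI[where f = "bundle_map A (iota g) p"])
  qed
  moreover have "tractor_I g c p \<bullet> iota g c p U = 0" for c p U
    by (simp add: tractor_I_def iota_def inner_prod_def)
  moreover have "connection_preserving A proj_transition (proj_tractor_conn g)
      (conf_tractor_conn g) (iota g)"
    unfolding connection_preserving_def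
  proof (intro allI impI ballI)
    fix W s c p b
    assume s: "smooth_section A proj_transition W s" and c: "c \<in> A" and p: "p \<in> W \<inter> fst c"
    have p': "p \<in> fst c" using p by blast
    note D = coord_deriv_bounded_linear[OF _ smooth_section_differentiable[OF assms(1) s c p], of _ b]
    have "coord_deriv c b (\<lambda>q. fst (iota g c q (s c q))) p
        = coord_deriv c b (\<lambda>q. k * snd (s c q)) p"
      by (rule coord_deriv_cong[OF op[OF c] p']) (simp add: iota[OF c])
    also have "\<dots> = k * coord_deriv c b (\<lambda>q. snd (s c q)) p"
      using D[OF bounded_linear_const_mult[OF bounded_linear_snd]] D[OF bounded_linear_snd] by simp
    finally have top: "coord_deriv c b (\<lambda>q. fst (iota g c q (s c q))) p
        = k * coord_deriv c b (\<lambda>q. snd (s c q)) p" .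
    \<comment> \<open>Stated for all \<open>q\<close>, so that it rewrites inside the functions
      being differentiated.\<close>
    have lower: "fst (snd (iota g c q U)) = fst U" "snd (snd (iota g c q U)) = snd U" for q U
      by (simp_all add: iota_def)
    \<comment> \<open>The projective connection uses the index order a b, the conformal one b a;
      symmetry lets the two terms k g_ba \<sigma> add up to 2 k g_ab \<sigma>.\<close>
    have "g c p $ b $ a = g c p $ a $ b" for a
      by (rule transpose_eqD[OF sym[OF c p']])
    then show "conf_tractor_conn g (\<lambda>c q. iota g c q (s c q)) c b p
        = iota g c p (proj_tractor_conn g s c b p)"
      unfolding conf_tractor_conn_def proj_tractor_conn_def Let_def top lower
        raise[OF c p'] iota[OF c p']
      \<comment> \<open>The Schouten tensors are replaced only now because \<open>raise\<close> is
        stated in terms of \<open>conf_schouten\<close>.\<close>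
      unfolding E(1,3)[OF c p' c p' c p']
      by (simp add: vec_eq_iff algebra_simps)
  qed
  ultimately show ?thesis by blast
qed

end
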